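(* Let $X$ be a finite connected rack with finite enveloping group $\overline{G_X}=As(X)/\langle g_{x_0}^n\rangle$, and let $\rho:X\to Conj(GL(V))$ and $\phi:X\to Conj(GL(V'))$ be strong representations of $X$ that are equivalent as rack representations, $\rho\sim\phi$. Then the induced group representations $\bar\rho:\overline{G_X}\to GL(V)$ and $\bar\phi:\overline{G_X}\to GL(V')$, determined by $\bar\rho_{g_x\langle g_{x_0}^n\rangle}=\rho_x$ and $\bar\phi_{g_x\langle g_{x_0}^n\rangle}=\phi_x$ for all $x\in X$, are also equivalent.
   Context: A rack is a set $X$ with a binary operation $\vartriangleright$ such that for every $x\in X$ the map $L_x:X\to X$, $L_x(y)=x\vartriangleright y$, is bijective, and $x\vartriangleright(y\vartriangleright z)=(x\vartriangleright y)\vartriangleright(x\vartriangleright z)$ for all $x,y,z\in X$. A rack homomorphism is a map preserving $\vartriangleright$. For a group $G$, $Conj(G)$ is the rack on the set $G$ with $g\vartriangleright h=ghg^{-1}$. $Inn(X)$ is the group of permutations of $X$ generated by all $L_x$, $x\in X$. The rack $X$ (assumed nonempty) is connected if $Inn(X)$ acts transitively on $X$. The associated group is $As(X)=\langle g_x,\ x\in X\mid g_{x\vartriangleright y}=g_xg_yg_x^{-1},\ x,y\in X\rangle$. For a finite connected rack all permutations $L_x$ have the same order, denoted $n$; moreover in $As(X)$ the element $g_x^n$ is central and $g_x^n=g_y^n$ for all $x,y\in X$. Fixing $x_0\in X$, the finite enveloping group is the quotient $\overline{G_X}=As(X)/\langle g_{x_0}^n\rangle$. A representation of a rack $X$ on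 a vector space $V$ is a rack homomorphism $\rho:X\to Conj(GL(V))$, $x\mapsto\rho_x$. A stabilizing family of $X$ is a finite family (sequence, repetitions allowed) $u_1,\dots,u_k$ of elements of $X$ with $L_{u_k}\cdots L_{u_1}=\mathrm{id}$. The representation $\rho$ is strong if $\rho_{u_k}\cdots\rho_{u_1}=\mathrm{id}$ for every stabilizing family. Every strong representation $\rho$ of a finite connected rack induces a group representation $\bar\rho$ of $\overline{G_X}$ with $\bar\rho_{g_x\langle g_{x_0}^n\rangle}=\rho_x$ for all $x\in X$. Two representations $(V,\rho)$, $(V',\phi)$ of a rack $X$ are equivalent, $\rho\sim\phi$, if there is a linear isomorphism $T:V\to V'$ with $\phi_xT=T\rho_x$ for all $x\in X$; equivalence of group representations is the usual one. *)

theory Defs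
  imports "HOL-Algebra.Group_Action" "HOL-Algebra.Generated_Groups" "HOL-Algebra.Multiplicative_Group"
begin

section \<open>Racks\<close>

record 'a rack = "'a partial_object" +
  rack_op :: "['a, 'a] \<Rightarrow> 'a" (infixl \<open>\<triangleright>\<index>\<close> 70)

locale rack =
  fixes X :: "('a, 'm) rack_scheme" (structure)
  assumes bij_left: "x \<in> carrier X \<Longrightarrow> bij_betw (\<lambda>y. x \<triangleright> y) (carrier X) (carrier X)"
    and self_distrib: "\<lbrakk>x \<in> carrier X; y \<in> carrier X; z \<in> carrier X\<rbrakk> \<Longrightarrow>
      x \<triangleright> (y \<triangleright> z) = (x \<triangleright> y) \<triangleright> (x \<triangleright> z)"

definition rack_hom :: "('a, 'm) rack_scheme \<Rightarrow> ('b, 'n) rack_scheme \<Rightarrow> ('a \<Rightarrow> 'b) set" where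
  "rack_hom X Y = {f \<in> carrier X \<rightarrow> carrier Y.
     \<forall>x\<in>carrier X. \<forall>y\<in>carrier X. f (x \<triangleright>\<^bsub>X\<^esub> y) = f x \<triangleright>\<^bsub>Y\<^esub> f y}"

definition Conj :: "('g, 'm) monoid_scheme \<Rightarrow> 'g rack" where
  "Conj G = \<lparr>carrier = carrier G, rack_op = (\<lambda>g h. g \<otimes>\<^bsub>G\<^esub> h \<otimes>\<^bsub>G\<^esub> inv\<^bsub>G\<^esub> g)\<rparr>"

text \<open>Like all elements of \<^const>\<open>BijGroup\<close>, left translations are extensional functions.\<close>

definition left_trans :: "('a, 'm) rack_scheme \<Rightarrow> 'a \<Rightarrow> 'a \<Rightarrow> 'a" where
  "left_trans X x = (\<lambda>y\<in>carrier X. x \<triangleright>\<^bsub>X\<^esub> y)"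

definition Inn :: "('a, 'm) rack_scheme \<Rightarrow> ('a \<Rightarrow> 'a) monoid" where
  "Inn X = BijGroup (carrier X)
     \<lparr>carrier := generate (BijGroup (carrier X)) (left_trans X ` carrier X)\<rparr>"

definition connected_rack :: "('a, 'm) rack_scheme \<Rightarrow> bool" where
  "connected_rack X \<longleftrightarrow>
     rack X \<and> carrier X \<noteq> {} \<and> transitive_action (Inn X) (carrier X) (\<lambda>g. g)"


section \<open>Groups given by generators and relations\<close>

text \<open>
  A word is a list of letters: \<open>(x, True)\<close> stands for the generator \<open>x\<close>, and
  \<open>(x, False)\<close> for its formal inverse. A relation \<open>u = v\<close> is a pair of words.
\<close>

type_synonym 'a gword = "('a \<times> bool) list"

inductive_set pres_cong :: "'a set \<Rightarrow> ('a gword \<times> 'a gword) set \<Rightarrow> ('a gword \<times> 'a gword) set"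
  for S R where
    refl: "u \<in> lists (S \<times> UNIV) \<Longrightarrow> (u, u) \<in> pres_cong S R"
  | sym: "(u, v) \<in> pres_cong S R \<Longrightarrow> (v, u) \<in> pres_cong S R"
  | trans: "(u, v) \<in> pres_cong S R \<Longrightarrow> (v, w) \<in> pres_cong S R \<Longrightarrow> (u, w) \<in> pres_cong S R"
  | append: "(u, u') \<in> pres_cong S R \<Longrightarrow> (v, v') \<in> pres_cong S R \<Longrightarrow>
      (u @ v, u' @ v') \<in> pres_cong S R"
  | cancel: "x \<in> S \<Longrightarrow> ([(x, b), (x, \<not> b)], []) \<in> pres_cong S R"
  | rel: "(u, v) \<in> R \<Longrightarrow> u \<in> lists (S \<times> UNIV) \<Longrightarrow> v \<in> lists (S \<times> UNIV) \<Longrightarrow>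
      (u, v) \<in> pres_cong S R"

definition presented_group :: "'a set \<Rightarrow> ('a gword \<times> 'a gword) set \<Rightarrow> 'a gword set monoid" where
  "presented_group S R =
     \<lparr>carrier = lists (S \<times> UNIV) // pres_cong S R,
      mult = (\<lambda>A B. \<Union>u\<in>A. \<Union>v\<in>B. pres_cong S R `` {u @ v}),
      one = pres_cong S R `` {[]}\<rparr>"


section \<open>The associated group and the finite enveloping group\<close>

definition As_rels :: "('a, 'm) rack_scheme \<Rightarrow> ('a gword \<times> 'a gword) set" where
  "As_rels X = {([(x \<triangleright>\<^bsub>X\<^esub> y, True)], [(x, True), (y, True), (x, False)]) | x y.
     x \<in> carrier X \<and> y \<in> carrier X}"

definition As :: "('a, 'm) rack_scheme \<Rightarrow> 'a gword set monoid" where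
  "As X = presented_group (carrier X) (As_rels X)"

definition As_gen :: "('a, 'm) rack_scheme \<Rightarrow> 'a \<Rightarrow> 'a gword set" where
  "As_gen X x = pres_cong (carrier X) (As_rels X) `` {[(x, True)]}"

text \<open>
  For a finite connected rack the order of \<open>left_trans X x\<close> does not depend on \<open>x\<close>; the
  order at the base point is taken as the number \<open>n\<close>.
\<close>

definition env_subgroup :: "('a, 'm) rack_scheme \<Rightarrow> 'a \<Rightarrow> 'a gword set set" where
  "env_subgroup X x0 =
     generate (As X)
       {As_gen X x0 [^]\<^bsub>As X\<^esub> group.ord (BijGroup (carrier X)) (left_trans X x0)}"

definition fin_env_group :: "('a, 'm) rack_scheme \<Rightarrow> 'a \<Rightarrow> 'a gword set set monoid" where
  "fin_env_group X x0 = As X Mod env_subgroup X x0"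

definition env_gen :: "('a, 'm) rack_scheme \<Rightarrow> 'a \<Rightarrow> 'a \<Rightarrow> 'a gword set set" where
  "env_gen X x0 x = env_subgroup X x0 #>\<^bsub>As X\<^esub> As_gen X x"


section \<open>Representations\<close>

definition GL :: "('k::field \<Rightarrow> 'v::ab_group_add \<Rightarrow> 'v) \<Rightarrow> ('v \<Rightarrow> 'v) monoid" where
  "GL s = \<lparr>carrier = {f. Vector_Spaces.linear s s f \<and> bij f}, mult = (\<circ>), one = id\<rparr>"

definition rack_rep ::
  "('a, 'm) rack_scheme \<Rightarrow> ('k::field \<Rightarrow> 'v::ab_group_add \<Rightarrow> 'v) \<Rightarrow> ('a \<Rightarrow> 'v \<Rightarrow> 'v) \<Rightarrow> bool" where
  "rack_rep X s \<rho> \<longleftrightarrow> vector_space s \<and> \<rho> \<in> rack_hom X (Conj (GL s))"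

text \<open>The product \<open>f u\<^sub>k \<otimes> \<dots> \<otimes> f u\<^sub>1\<close> along a family \<open>[u\<^sub>1, \<dots>, u\<^sub>k]\<close>.\<close>

definition family_prod :: "('g, 'm) monoid_scheme \<Rightarrow> ('a \<Rightarrow> 'g) \<Rightarrow> 'a list \<Rightarrow> 'g" where
  "family_prod G f us = foldl (\<lambda>g u. f u \<otimes>\<^bsub>G\<^esub> g) \<one>\<^bsub>G\<^esub> us"

definition stabilizing_family :: "('a, 'm) rack_scheme \<Rightarrow> 'a list \<Rightarrow> bool" where
  "stabilizing_family X us \<longleftrightarrow> us \<in> lists (carrier X) \<and>
     family_prod (BijGroup (carrier X)) (left_trans X) us = \<one>\<^bsub>BijGroup (carrier X)\<^esub>"

definition strong_rep ::
  "('a, 'm) rack_scheme \<Rightarrow> ('k::field \<Rightarrow> 'v::ab_group_add \<Rightarrow> 'v) \<Rightarrow> ('a \<Rightarrow> 'v \<Rightarrow> 'v) \<Rightarrow> bool" where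
  "strong_rep X s \<rho> \<longleftrightarrow> rack_rep X s \<rho> \<and>
     (\<forall>us. stabilizing_family X us \<longrightarrow> family_prod (GL s) \<rho> us = \<one>\<^bsub>GL s\<^esub>)"

definition rack_rep_equiv ::
  "('a, 'm) rack_scheme \<Rightarrow> ('k::field \<Rightarrow> 'v::ab_group_add \<Rightarrow> 'v) \<Rightarrow> ('a \<Rightarrow> 'v \<Rightarrow> 'v) \<Rightarrow>
   ('k \<Rightarrow> 'w::ab_group_add \<Rightarrow> 'w) \<Rightarrow> ('a \<Rightarrow> 'w \<Rightarrow> 'w) \<Rightarrow> bool" where
  "rack_rep_equiv X s \<rho> t \<phi> \<longleftrightarrow> rack_rep X s \<rho> \<and> rack_rep X t \<phi> \<and>
     (\<exists>T. Vector_Spaces.linear s t T \<and> bij T \<and> (\<forall>x\<in>carrier X. \<phi> x \<circ> T = T \<circ> \<rho> x))"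

definition group_rep ::
  "('g, 'm) monoid_scheme \<Rightarrow> ('k::field \<Rightarrow> 'v::ab_group_add \<Rightarrow> 'v) \<Rightarrow> ('g \<Rightarrow> 'v \<Rightarrow> 'v) \<Rightarrow> bool" where
  "group_rep G s \<rho> \<longleftrightarrow> group G \<and> vector_space s \<and> \<rho> \<in> hom G (GL s)"

definition group_rep_equiv ::
  "('g, 'm) monoid_scheme \<Rightarrow> ('k::field \<Rightarrow> 'v::ab_group_add \<Rightarrow> 'v) \<Rightarrow> ('g \<Rightarrow> 'v \<Rightarrow> 'v) \<Rightarrow>
   ('k \<Rightarrow> 'w::ab_group_add \<Rightarrow> 'w) \<Rightarrow> ('g \<Rightarrow> 'w \<Rightarrow> 'w) \<Rightarrow> bool" where
  "group_rep_equiv G s \<rho> t \<phi> \<longleftrightarrow> group_rep G s \<rho> \<and> group_rep G t \<phi> \<and>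
     (\<exists>T. Vector_Spaces.linear s t T \<and> bij T \<and> (\<forall>g\<in>carrier G. \<phi> g \<circ> T = T \<circ> \<rho> g))"

text \<open>Extensionality only makes the values outside the carrier unique.\<close>

definition induced_rep ::
  "('a, 'm) rack_scheme \<Rightarrow> 'a \<Rightarrow> ('k::field \<Rightarrow> 'v::ab_group_add \<Rightarrow> 'v) \<Rightarrow> ('a \<Rightarrow> 'v \<Rightarrow> 'v) \<Rightarrow>
   ('a gword set set \<Rightarrow> 'v \<Rightarrow> 'v)" where
  "induced_rep X x0 s \<rho> = (THE r. group_rep (fin_env_group X x0) s r \<and>
     r \<in> extensional (carrier (fin_env_group X x0)) \<and>
     (\<forall>x\<in>carrier X. r (env_gen X x0 x) = \<rho> x))"


section \<open>Existence and uniqueness of the induced representation\<close>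

lemma pres_cong_words:
  "(u, v) \<in> pres_cong S R \<Longrightarrow> u \<in> lists (S \<times> UNIV) \<and> v \<in> lists (S \<times> UNIV)"
  by (induction rule: pres_cong.induct) auto

lemma equiv_pres_cong: "equiv (lists (S \<times> UNIV)) (pres_cong S R)"
proof (rule equivI)
  show "refl_on (lists (S \<times> UNIV)) (pres_cong S R)"
    by (rule refl_onI) (rule pres_cong.refl)
  show "sym (pres_cong S R)" by (rule symI) (rule pres_cong.sym)
  show "trans (pres_cong S R)" by (rule transI) (rule pres_cong.trans)
  show "pres_cong S R \<subseteq> lists (S \<times> UNIV) \<times> lists (S \<times> UNIV)"
    using pres_cong_words by fast
qed

lemma pres_class_mult:
  assumes "u \<in> lists (S \<times> UNIV)" "v \<in> lists (S \<times> UNIV)"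
  shows "(pres_cong S R `` {u}) \<otimes>\<^bsub>presented_group S R\<^esub> (pres_cong S R `` {v}) =
    pres_cong S R `` {u @ v}"
proof -
  let ?P = "pres_cong S R"
  have "?P `` {u' @ v'} = ?P `` {u @ v}" if "u' \<in> ?P `` {u}" "v' \<in> ?P `` {v}" for u' v'
    using equiv_class_eq[OF equiv_pres_cong pres_cong.append[of u u' S R v v']] that by blast
  then have "(\<Union>u'\<in>?P `` {u}. \<Union>v'\<in>?P `` {v}. ?P `` {u' @ v'}) =
      (\<Union>u'\<in>?P `` {u}. \<Union>v'\<in>?P `` {v}. ?P `` {u @ v})"
    by (intro SUP_cong HOL.refl)
  moreover have "u \<in> ?P `` {u}" "v \<in> ?P `` {v}"
    using assms by (simp_all only: Image_singleton_iff pres_cong.refl)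
  ultimately show ?thesis
    unfolding presented_group_def by (simp only: monoid.simps) blast
qed

definition inv_word :: "'a gword \<Rightarrow> 'a gword" where
  "inv_word w = rev (map (\<lambda>(x, b). (x, \<not> b)) w)"

lemma inv_word_in: "w \<in> lists (S \<times> UNIV) \<Longrightarrow> inv_word w \<in> lists (S \<times> UNIV)"
  by (induction w) (auto simp: inv_word_def)

lemma inv_word_cancel: "w \<in> lists (S \<times> UNIV) \<Longrightarrow> (inv_word w @ w, []) \<in> pres_cong S R"
proof (induction w rule: lists.induct)
  case Nil
  then show ?case by (auto simp: inv_word_def intro: pres_cong.refl)
next
  case (Cons a w)
  obtain x b where a: "a = (x, b)" "x \<in> S" using Cons by auto
  have iw: "(inv_word w, inv_word w) \<in> pres_cong S R" and ww: "(w, w) \<in> pres_cong S R"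
    using Cons inv_word_in[of w S] by (simp_all add: pres_cong.refl del: in_lists_conv_set)
  have "([(x, \<not> b), (x, b)], []) \<in> pres_cong S R"
    using pres_cong.cancel[OF a(2), of "\<not> b"] by simp
  from pres_cong.append[OF iw pres_cong.append[OF this ww]]
  have "(inv_word (a # w) @ a # w, inv_word w @ w) \<in> pres_cong S R"
    by (simp add: a inv_word_def)
  from pres_cong.trans[OF this] show ?case using Cons by simp
qed

lemma group_presented_group: "group (presented_group S R)"
proof -
  let ?G = "presented_group S R"
  have car: "A \<in> carrier ?G \<longleftrightarrow> (\<exists>w\<in>lists (S \<times> UNIV). A = pres_cong S R `` {w})" for A
    by (auto simp: presented_group_def quotient_def)
  have one: "\<one>\<^bsub>?G\<^esub> = pres_cong S R `` {[]}" by (simp add: presented_group_def)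
  show ?thesis
  proof (rule groupI)
    fix A B assume "A \<in> carrier ?G" "B \<in> carrier ?G"
    then obtain u v where uv: "u \<in> lists (S \<times> UNIV)" "v \<in> lists (S \<times> UNIV)"
      and eq: "A = pres_cong S R `` {u}" "B = pres_cong S R `` {v}"
      unfolding car by blast
    have "u @ v \<in> lists (S \<times> UNIV)"
      using uv by (simp only: append_in_lists_conv)
    then show "A \<otimes>\<^bsub>?G\<^esub> B \<in> carrier ?G"
      unfolding eq pres_class_mult[OF uv] car by blast
  next
    show "\<one>\<^bsub>?G\<^esub> \<in> carrier ?G" by (auto simp: car one)
  next
    fix A B C assume "A \<in> carrier ?G" "B \<in> carrier ?G" "C \<in> carrier ?G"
    then obtain u v w where uvw: "u \<in> lists (S \<times> UNIV)" "v \<in> lists (S \<times> UNIV)"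
        "w \<in> lists (S \<times> UNIV)"
      and eq: "A = pres_cong S R `` {u}" "B = pres_cong S R `` {v}" "C = pres_cong S R `` {w}"
      unfolding car by blast
    have "u @ v \<in> lists (S \<times> UNIV)" "v @ w \<in> lists (S \<times> UNIV)"
      using uvw by (simp_all only: append_in_lists_conv)
    then show "A \<otimes>\<^bsub>?G\<^esub> B \<otimes>\<^bsub>?G\<^esub> C = A \<otimes>\<^bsub>?G\<^esub> (B \<otimes>\<^bsub>?G\<^esub> C)"
      unfolding eq using uvw by (simp only: pres_class_mult append_assoc)
  next
    fix A assume "A \<in> carrier ?G"
    then show "\<one>\<^bsub>?G\<^esub> \<otimes>\<^bsub>?G\<^esub> A = A"
      unfolding car one using pres_class_mult[OF lists.Nil] by auto
  next
    fix A assume "A \<in> carrier ?G"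
    then obtain w where w: "w \<in> lists (S \<times> UNIV)" "A = pres_cong S R `` {w}"
      by (auto simp: car)
    have "(pres_cong S R `` {inv_word w}) \<otimes>\<^bsub>?G\<^esub> A = \<one>\<^bsub>?G\<^esub>"
      unfolding one w(2) pres_class_mult[OF inv_word_in[OF w(1)] w(1)]
      by (rule equiv_class_eq[OF equiv_pres_cong inv_word_cancel[OF w(1)]])
    moreover have "pres_cong S R `` {inv_word w} \<in> carrier ?G"
      using w inv_word_in by (auto simp: car)
    ultimately show "\<exists>B\<in>carrier ?G. B \<otimes>\<^bsub>?G\<^esub> A = \<one>\<^bsub>?G\<^esub>" by blast
  qed
qed

definition eval_word :: "('g, 'm) monoid_scheme \<Rightarrow> ('a \<Rightarrow> 'g) \<Rightarrow> 'a gword \<Rightarrow> 'g" where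
  "eval_word H f w =
     foldr (\<lambda>(x, b) h. (if b then f x else inv\<^bsub>H\<^esub> f x) \<otimes>\<^bsub>H\<^esub> h) w \<one>\<^bsub>H\<^esub>"

lemma eval_word_simps [simp]:
  "eval_word H f [] = \<one>\<^bsub>H\<^esub>"
  "eval_word H f ((x, b) # w) = (if b then f x else inv\<^bsub>H\<^esub> f x) \<otimes>\<^bsub>H\<^esub> eval_word H f w"
  by (auto simp: eval_word_def)

context
  fixes H :: "('g, 'm) monoid_scheme" and f :: "'a \<Rightarrow> 'g" and S :: "'a set"
    and R :: "('a gword \<times> 'a gword) set"
  assumes H: "group H" and f: "f \<in> S \<rightarrow> carrier H"
begin

interpretation H: group H by (rule H)

lemma eval_word_closed: "w \<in> lists (S \<times> UNIV) \<Longrightarrow> eval_word H f w \<in> carrier H"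
  by (induction w rule: lists.induct) (use f in \<open>auto simp: Pi_iff\<close>)

lemma eval_word_append:
  "u \<in> lists (S \<times> UNIV) \<Longrightarrow> v \<in> lists (S \<times> UNIV) \<Longrightarrow>
   eval_word H f (u @ v) = eval_word H f u \<otimes>\<^bsub>H\<^esub> eval_word H f v"
proof (induction u rule: lists.induct)
  case Nil
  then show ?case using eval_word_closed by simp
next
  case (Cons a u)
  then show ?case using f eval_word_closed by (cases a) (auto simp: Pi_iff H.m_assoc)
qed

lemma presented_group_universal:
  assumes R: "\<And>u v. (u, v) \<in> R \<Longrightarrow> u \<in> lists (S \<times> UNIV) \<Longrightarrow> v \<in> lists (S \<times> UNIV) \<Longrightarrow>
    eval_word H f u = eval_word H f v"
  obtains h where "h \<in> hom (presented_group S R) H"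
    "\<And>x. x \<in> S \<Longrightarrow> h (pres_cong S R `` {[(x, True)]}) = f x"
proof -
  have resp: "eval_word H f u = eval_word H f v" if "(u, v) \<in> pres_cong S R" for u v
    using that
  proof (induction rule: pres_cong.induct)
    case (append u u' v v')
    then show ?case by (simp add: eval_word_append pres_cong_words[of u u'] pres_cong_words[of v v'])
  next
    case (cancel x b)
    then show ?case using f by (auto simp: Pi_iff)
  next
    case (rel u v)
    then show ?case by (rule R)
  qed auto
  define h where "h A = eval_word H f (SOME w. w \<in> A)" for A
  have h: "h (pres_cong S R `` {w}) = eval_word H f w" if "w \<in> lists (S \<times> UNIV)" for w
  proof -
    have "w \<in> pres_cong S R `` {w}" using that by (auto intro: pres_cong.refl)
    then have "(SOME w'. w' \<in> pres_cong S R `` {w}) \<in> pres_cong S R `` {w}"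
      by (rule someI[where P = "\<lambda>w'. w' \<in> pres_cong S R `` {w}"])
    then show ?thesis unfolding h_def using resp by auto
  qed
  have "h \<in> hom (presented_group S R) H"
  proof (rule homI)
    fix A assume "A \<in> carrier (presented_group S R)"
    then obtain u where "u \<in> lists (S \<times> UNIV)" "A = pres_cong S R `` {u}"
      by (auto simp: presented_group_def quotient_def)
    then show "h A \<in> carrier H" by (simp only: h eval_word_closed)
  next
    fix A B assume "A \<in> carrier (presented_group S R)" "B \<in> carrier (presented_group S R)"
    then obtain u v where "u \<in> lists (S \<times> UNIV)" "v \<in> lists (S \<times> UNIV)"
      "A = pres_cong S R `` {u}" "B = pres_cong S R `` {v}"
      by (auto simp: presented_group_def quotient_def)
    then show "h (A \<otimes>\<^bsub>presented_group S R\<^esub> B) = h A \<otimes>\<^bsub>H\<^esub> h B"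
      by (simp add: pres_class_mult h eval_word_append)
  qed
  moreover have "h (pres_cong S R `` {[(x, True)]}) = f x" if "x \<in> S" for x
    using that f by (auto simp: h Pi_iff)
  ultimately show ?thesis using that by blast
qed

end

lemma group_As: "group (As X)"
  by (simp add: As_def group_presented_group)

lemma As_gen_closed: "x \<in> carrier X \<Longrightarrow> As_gen X x \<in> carrier (As X)"
  by (auto simp: As_gen_def As_def presented_group_def intro!: quotientI)

lemma As_generate: "carrier (As X) = generate (As X) (As_gen X ` carrier X)"
proof
  interpret group "As X" by (rule group_As)
  let ?P = "pres_cong (carrier X) (As_rels X)"
  show "generate (As X) (As_gen X ` carrier X) \<subseteq> carrier (As X)"
    by (rule generate_incl) (auto simp: As_gen_closed)
  have inv: "inv\<^bsub>As X\<^esub> As_gen X x = ?P `` {[(x, False)]}" if x: "x \<in> carrier X" for x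
  proof (rule inv_equality)
    show "?P `` {[(x, False)]} \<otimes>\<^bsub>As X\<^esub> As_gen X x = \<one>\<^bsub>As X\<^esub>"
      using x equiv_class_eq[OF equiv_pres_cong pres_cong.cancel[of x "carrier X" False "As_rels X"]]
      by (simp add: As_def As_gen_def pres_class_mult presented_group_def[THEN arg_cong[where f=one]])
    show "As_gen X x \<in> carrier (As X)" by (rule As_gen_closed[OF x])
    show "?P `` {[(x, False)]} \<in> carrier (As X)"
      using x by (auto simp: As_def presented_group_def intro!: quotientI)
  qed
  have "?P `` {w} \<in> generate (As X) (As_gen X ` carrier X)" if "w \<in> lists (carrier X \<times> UNIV)" for w
    using that
  proof (induction rule: lists.induct)
    case Nil
    have "?P `` {[]} = \<one>\<^bsub>As X\<^esub>" by (simp add: As_def presented_group_def)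
    then show ?case by (simp add: generate.one)
  next
    case (Cons a w)
    then obtain x b where a: "a = (x, b)" "x \<in> carrier X" by auto
    have "?P `` {[a]} \<in> generate (As X) (As_gen X ` carrier X)"
    proof (cases b)
      case True
      then show ?thesis using a by (auto simp: As_gen_def intro: generate.incl)
    next
      case False
      then show ?thesis using a generate.inv[of "As_gen X x" _ "As X"] inv[OF a(2)] by auto
    qed
    from generate.eng[OF this Cons.IH] show ?case
      using Cons a by (simp add: As_def pres_class_mult)
  qed
  then show "carrier (As X) \<subseteq> generate (As X) (As_gen X ` carrier X)"
    by (auto simp: As_def presented_group_def quotient_def)
qed

lemma As_gen_rel:
  assumes "rack X" "x \<in> carrier X" "y \<in> carrier X"
  shows "As_gen X (x \<triangleright>\<^bsub>X\<^esub> y) = As_gen X x \<otimes>\<^bsub>As X\<^esub> As_gen X y \<otimes>\<^bsub>As X\<^esub> inv\<^bsub>As X\<^esub> As_gen X x"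
proof -
  interpret group "As X" by (rule group_As)
  let ?P = "pres_cong (carrier X) (As_rels X)"
  have xy: "x \<triangleright>\<^bsub>X\<^esub> y \<in> carrier X"
    using rack.bij_left[OF assms(1,2)] assms(3) by (auto simp: bij_betw_def)
  have "([(x \<triangleright>\<^bsub>X\<^esub> y, True)], [(x, True), (y, True), (x, False)]) \<in> ?P"
    by (rule pres_cong.rel) (use assms xy in \<open>auto simp: As_rels_def\<close>)
  from pres_cong.append[OF this pres_cong.refl[of "[(x, True)]"]] assms
  have 1: "([(x \<triangleright>\<^bsub>X\<^esub> y, True), (x, True)], [(x, True), (y, True)] @ [(x, False), (x, True)]) \<in> ?P"
    by simp
  have 2: "([(x, True), (y, True)] @ [(x, False), (x, True)], [(x, True), (y, True)] @ []) \<in> ?P"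
    using pres_cong.cancel[of x "carrier X" False "As_rels X"] assms
    by (intro pres_cong.append pres_cong.refl) auto
  have "As_gen X (x \<triangleright>\<^bsub>X\<^esub> y) \<otimes>\<^bsub>As X\<^esub> As_gen X x = As_gen X x \<otimes>\<^bsub>As X\<^esub> As_gen X y"
    using equiv_class_eq[OF equiv_pres_cong pres_cong.trans[OF 1 2]] assms xy
    by (simp add: As_gen_def As_def pres_class_mult)
  then show ?thesis
    using assms xy inv_solve_right[of "As_gen X (x \<triangleright>\<^bsub>X\<^esub> y)" "As_gen X x \<otimes>\<^bsub>As X\<^esub> As_gen X y" "As_gen X x"]
    by (simp add: As_gen_closed)
qed

lemma group_GL:
  assumes "vector_space s"
  shows "group (GL s)"
proof (rule groupI)
  fix f g assume "f \<in> carrier (GL s)" "g \<in> carrier (GL s)"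
  then show "f \<otimes>\<^bsub>GL s\<^esub> g \<in> carrier (GL s)"
    by (auto simp: GL_def intro: Vector_Spaces.linear_compose bij_comp)
next
  show "\<one>\<^bsub>GL s\<^esub> \<in> carrier (GL s)"
    using vector_space.linear_id[OF assms] by (simp add: GL_def)
next
  fix f assume f: "f \<in> carrier (GL s)"
  then interpret f: Vector_Spaces.linear s s f by (simp add: GL_def)
  have b: "bij f" using f by (simp add: GL_def)
  have "Vector_Spaces.linear s s (inv_into UNIV f)"
  proof (unfold_locales)
    fix x y c
    show "inv_into UNIV f (x + y) = inv_into UNIV f x + inv_into UNIV f y"
      by (rule inv_f_eq) (use b in \<open>auto simp: f.add bij_is_inj bij_is_surj surj_f_inv_f\<close>)
    show "inv_into UNIV f (s c x) = s c (inv_into UNIV f x)"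
      by (rule inv_f_eq) (use b in \<open>auto simp: f.scale bij_is_inj bij_is_surj surj_f_inv_f\<close>)
  qed
  then have "inv_into UNIV f \<in> carrier (GL s)" "inv_into UNIV f \<otimes>\<^bsub>GL s\<^esub> f = \<one>\<^bsub>GL s\<^esub>"
    using b by (auto simp: GL_def bij_imp_bij_inv bij_is_inj)
  then show "\<exists>g\<in>carrier (GL s). g \<otimes>\<^bsub>GL s\<^esub> f = \<one>\<^bsub>GL s\<^esub>" by blast
qed (auto simp: GL_def o_assoc)

lemma family_prod_replicate:
  assumes "group G" "f x \<in> carrier G"
  shows "family_prod G f (replicate n x) = f x [^]\<^bsub>G\<^esub> n"
proof -
  interpret group G by (rule assms)
  have "family_prod G f (us @ [u]) = f u \<otimes>\<^bsub>G\<^esub> family_prod G f us" for us u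
    by (simp add: family_prod_def)
  moreover have "family_prod G f [] = \<one>\<^bsub>G\<^esub>" by (simp add: family_prod_def)
  ultimately show ?thesis
  proof (induction n)
    case (Suc n)
    then have "family_prod G f (replicate (Suc n) x) = f x \<otimes>\<^bsub>G\<^esub> f x [^]\<^bsub>G\<^esub> n"
      by (simp del: replicate_Suc nat_pow_Suc add: replicate_append_same[symmetric] replicate_Suc[of n x])
    then show ?case using nat_pow_Suc2[OF assms(2), of n] by simp
  qed simp
qed

lemma left_trans_Bij:
  assumes "rack X" "x \<in> carrier X"
  shows "left_trans X x \<in> carrier (BijGroup (carrier X))"
  using rack.bij_left[OF assms] by (simp add: left_trans_def BijGroup_def Bij_def)

lemma BijGroup_mult_apply:
  "f \<in> carrier (BijGroup S) \<Longrightarrow> g \<in> carrier (BijGroup S) \<Longrightarrow> y \<in> S \<Longrightarrow>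
    (f \<otimes>\<^bsub>BijGroup S\<^esub> g) y = f (g y)"
  by (simp add: BijGroup_def compose_def)

lemma left_trans_apply: "y \<in> carrier X \<Longrightarrow> left_trans X x y = x \<triangleright>\<^bsub>X\<^esub> y"
  by (simp add: left_trans_def)

lemma left_trans_pow:
  assumes "rack X" "x \<in> carrier X" "y \<in> carrier X"
  shows "(left_trans X x [^]\<^bsub>BijGroup (carrier X)\<^esub> (k::nat)) y = ((\<lambda>y. x \<triangleright>\<^bsub>X\<^esub> y) ^^ k) y
    \<and> ((\<lambda>y. x \<triangleright>\<^bsub>X\<^esub> y) ^^ k) y \<in> carrier X"
proof -
  interpret B: group "BijGroup (carrier X)" by (rule group_BijGroup)
  note L = left_trans_Bij[OF assms(1,2)]
  show ?thesis
  proof (induction k)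
    case 0
    show ?case using assms by (simp add: BijGroup_def)
  next
    case (Suc k)
    have "left_trans X x [^]\<^bsub>BijGroup (carrier X)\<^esub> Suc k =
        left_trans X x \<otimes>\<^bsub>BijGroup (carrier X)\<^esub> (left_trans X x [^]\<^bsub>BijGroup (carrier X)\<^esub> k)"
      using B.nat_pow_Suc2[OF L] by simp
    moreover have "left_trans X x [^]\<^bsub>BijGroup (carrier X)\<^esub> k \<in> carrier (BijGroup (carrier X))"
      using L by simp
    ultimately have "(left_trans X x [^]\<^bsub>BijGroup (carrier X)\<^esub> Suc k) y = x \<triangleright>\<^bsub>X\<^esub> ((\<lambda>y. x \<triangleright>\<^bsub>X\<^esub> y) ^^ k) y"
      using BijGroup_mult_apply[OF L _ assms(3)] Suc by (simp only: left_trans_apply)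
    moreover have "x \<triangleright>\<^bsub>X\<^esub> ((\<lambda>y. x \<triangleright>\<^bsub>X\<^esub> y) ^^ k) y \<in> carrier X"
      using rack.bij_left[OF assms(1,2)] Suc by (auto simp: bij_betw_def)
    ultimately show ?case by simp
  qed
qed

lemma As_gen_pow_central:
  assumes X: "rack X" and x: "x \<in> carrier X" and a: "a \<in> carrier (As X)"
  defines "z \<equiv> As_gen X x [^]\<^bsub>As X\<^esub> group.ord (BijGroup (carrier X)) (left_trans X x)"
  shows "z \<otimes>\<^bsub>As X\<^esub> a = a \<otimes>\<^bsub>As X\<^esub> z"
proof -
  interpret group "As X" by (rule group_As)
  interpret B: group "BijGroup (carrier X)" by (rule group_BijGroup)
  let ?n = "B.ord (left_trans X x)"
  have gx: "As_gen X x \<in> carrier (As X)" by (rule As_gen_closed[OF x])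
  then have z: "z \<in> carrier (As X)" by (simp add: z_def)
  have step: "As_gen X x [^]\<^bsub>As X\<^esub> k \<otimes>\<^bsub>As X\<^esub> As_gen X y =
      As_gen X (((\<lambda>y. x \<triangleright>\<^bsub>X\<^esub> y) ^^ k) y) \<otimes>\<^bsub>As X\<^esub> As_gen X x [^]\<^bsub>As X\<^esub> k"
    if y: "y \<in> carrier X" for k :: nat and y
  proof (induction k)
    case 0
    show ?case using y by (simp add: As_gen_closed)
  next
    case (Suc k)
    let ?y = "((\<lambda>y. x \<triangleright>\<^bsub>X\<^esub> y) ^^ k) y"
    have y': "?y \<in> carrier X" using left_trans_pow[OF X x y] by blast
    have gy: "As_gen X y \<in> carrier (As X)" "As_gen X ?y \<in> carrier (As X)"
      using y y' by (auto intro: As_gen_closed)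
    have rel: "As_gen X x \<otimes>\<^bsub>As X\<^esub> As_gen X ?y = As_gen X (x \<triangleright>\<^bsub>X\<^esub> ?y) \<otimes>\<^bsub>As X\<^esub> As_gen X x"
      unfolding As_gen_rel[OF X x y'] using gx gy by (simp add: m_assoc)
    have gxy: "As_gen X (x \<triangleright>\<^bsub>X\<^esub> ?y) \<in> carrier (As X)"
      unfolding As_gen_rel[OF X x y'] using gx gy by simp
    have "As_gen X x [^]\<^bsub>As X\<^esub> Suc k \<otimes>\<^bsub>As X\<^esub> As_gen X y =
        As_gen X x \<otimes>\<^bsub>As X\<^esub> (As_gen X x [^]\<^bsub>As X\<^esub> k \<otimes>\<^bsub>As X\<^esub> As_gen X y)"
      unfolding nat_pow_Suc2[OF gx] using gx gy by (simp add: m_assoc)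
    also have "\<dots> = (As_gen X x \<otimes>\<^bsub>As X\<^esub> As_gen X ?y) \<otimes>\<^bsub>As X\<^esub> As_gen X x [^]\<^bsub>As X\<^esub> k"
      unfolding Suc using gx gy by (simp add: m_assoc)
    also have "\<dots> = As_gen X (x \<triangleright>\<^bsub>X\<^esub> ?y) \<otimes>\<^bsub>As X\<^esub> (As_gen X x \<otimes>\<^bsub>As X\<^esub> As_gen X x [^]\<^bsub>As X\<^esub> k)"
      unfolding rel using gx gxy by (simp add: m_assoc)
    finally show ?case unfolding nat_pow_Suc2[OF gx] by simp
  qed
  have comm: "z \<otimes>\<^bsub>As X\<^esub> As_gen X y = As_gen X y \<otimes>\<^bsub>As X\<^esub> z" if y: "y \<in> carrier X" for y
  proof -
    have "left_trans X x [^]\<^bsub>BijGroup (carrier X)\<^esub> ?n = \<one>\<^bsub>BijGroup (carrier X)\<^esub>"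
      using B.pow_ord_eq_1 left_trans_Bij[OF X x] by blast
    then have "((\<lambda>y. x \<triangleright>\<^bsub>X\<^esub> y) ^^ ?n) y = y"
      using left_trans_pow[OF X x y, of ?n] y by (simp add: BijGroup_def)
    then show ?thesis using step[OF y, of ?n] by (simp add: z_def)
  qed
  have "a \<in> generate (As X) (As_gen X ` carrier X)" using a As_generate by blast
  then show ?thesis
  proof (induction rule: generate.induct)
    case one
    then show ?case using z by simp
  next
    case (incl h)
    then show ?case using comm by auto
  next
    case (inv h)
    then have h: "h \<in> carrier (As X)" "z \<otimes>\<^bsub>As X\<^esub> h = h \<otimes>\<^bsub>As X\<^esub> z" using comm As_gen_closed by auto
    have "z = h \<otimes>\<^bsub>As X\<^esub> (z \<otimes>\<^bsub>As X\<^esub> inv\<^bsub>As X\<^esub> h)"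
      using m_assoc[of h z "inv\<^bsub>As X\<^esub> h"] m_assoc[of z h "inv\<^bsub>As X\<^esub> h"] r_inv[OF h(1)] h z
      by (simp only: inv_closed r_one)
    with h(1) z show ?case
      using inv_solve_left[of "z \<otimes>\<^bsub>As X\<^esub> inv\<^bsub>As X\<^esub> h" h z] by simp
  next
    case (eng h1 h2)
    then have "h1 \<in> carrier (As X)" "h2 \<in> carrier (As X)" using As_generate by blast+
    then show ?case
      using eng.IH m_assoc[of z h1 h2] m_assoc[of h1 z h2] m_assoc[of h1 h2 z] z by simp
  qed
qed

lemma env_subgroup_normal:
  assumes X: "rack X" and x0: "x0 \<in> carrier X"
  shows "env_subgroup X x0 \<lhd> As X"
proof -
  interpret group "As X" by (rule group_As)
  let ?z = "As_gen X x0 [^]\<^bsub>As X\<^esub> group.ord (BijGroup (carrier X)) (left_trans X x0)"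
  have z: "?z \<in> carrier (As X)" by (simp add: As_gen_closed x0)
  show ?thesis unfolding env_subgroup_def
  proof (rule normal_generateI)
    show "{?z} \<subseteq> carrier (As X)" using z by simp
    fix h g assume h: "h \<in> {?z}" and g: "g \<in> carrier (As X)"
    have "g \<otimes>\<^bsub>As X\<^esub> ?z \<otimes>\<^bsub>As X\<^esub> inv\<^bsub>As X\<^esub> g = ?z \<otimes>\<^bsub>As X\<^esub> (g \<otimes>\<^bsub>As X\<^esub> inv\<^bsub>As X\<^esub> g)"
      unfolding As_gen_pow_central[OF X x0 g, symmetric] by (rule m_assoc[OF z g inv_closed[OF g]])
    also have "\<dots> = ?z" unfolding r_inv[OF g] by (rule r_one[OF z])
    finally show "g \<otimes>\<^bsub>As X\<^esub> h \<otimes>\<^bsub>As X\<^esub> inv\<^bsub>As X\<^esub> g \<in> {?z}"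
      using h by simp
  qed
qed

lemma group_fin_env_group: "rack X \<Longrightarrow> x0 \<in> carrier X \<Longrightarrow> group (fin_env_group X x0)"
  unfolding fin_env_group_def by (rule normal.factorgroup_is_group[OF env_subgroup_normal])

lemma env_gen_closed: "x \<in> carrier X \<Longrightarrow> env_gen X x0 x \<in> carrier (fin_env_group X x0)"
  unfolding env_gen_def fin_env_group_def carrier_FactGroup by (intro imageI As_gen_closed)

lemma fin_env_group_generate:
  assumes X: "rack X" and x0: "x0 \<in> carrier X"
  shows "carrier (fin_env_group X x0) = generate (fin_env_group X x0) (env_gen X x0 ` carrier X)"
proof -
  interpret N: normal "env_subgroup X x0" "As X" by (rule env_subgroup_normal[OF X x0])
  interpret h: group_hom "As X" "fin_env_group X x0" "\<lambda>a. env_subgroup X x0 #>\<^bsub>As X\<^esub> a"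
    unfolding group_hom_def group_hom_axioms_def
    using N.r_coset_hom_Mod group_As[of X] group_fin_env_group[OF X x0]
    by (simp add: fin_env_group_def)
  have "carrier (fin_env_group X x0) = (\<lambda>a. env_subgroup X x0 #>\<^bsub>As X\<^esub> a) ` carrier (As X)"
    by (simp add: fin_env_group_def carrier_FactGroup)
  also have "\<dots> = generate (fin_env_group X x0)
      ((\<lambda>a. env_subgroup X x0 #>\<^bsub>As X\<^esub> a) ` As_gen X ` carrier X)"
    unfolding As_generate[of X]
    by (rule h.generate_img[symmetric]) (use As_gen_closed[of _ X] in blast)
  finally show ?thesis by (simp add: image_image env_gen_def)
qed

lemma induced_rep_ex1:
  assumes X: "rack X" and x0: "x0 \<in> carrier X" and \<rho>: "strong_rep X s \<rho>"
  shows "\<exists>!r. group_rep (fin_env_group X x0) s r \<and>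
     r \<in> extensional (carrier (fin_env_group X x0)) \<and>
     (\<forall>x\<in>carrier X. r (env_gen X x0 x) = \<rho> x)"
proof (rule ex_ex1I)
  have s: "vector_space s" and hom: "\<rho> \<in> rack_hom X (Conj (GL s))"
    using \<rho> by (auto simp: strong_rep_def rack_rep_def)
  interpret GL: group "GL s" by (rule group_GL[OF s])
  interpret A: group "As X" by (rule group_As)
  interpret B: group "BijGroup (carrier X)" by (rule group_BijGroup)
  interpret F: group "fin_env_group X x0" by (rule group_fin_env_group[OF X x0])
  have \<rho>_in: "\<rho> \<in> carrier X \<rightarrow> carrier (GL s)"
    using hom by (simp add: rack_hom_def Conj_def)
  obtain h where h: "h \<in> hom (As X) (GL s)" "\<And>x. x \<in> carrier X \<Longrightarrow> h (As_gen X x) = \<rho> x"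
    unfolding As_def As_gen_def
  proof (rule presented_group_universal[OF group_GL[OF s] \<rho>_in, of "As_rels X"])
    fix u v assume "(u, v) \<in> As_rels X"
    then show "eval_word (GL s) \<rho> u = eval_word (GL s) \<rho> v"
      using hom \<rho>_in by (auto simp: As_rels_def rack_hom_def Conj_def Pi_iff GL.m_assoc)
  qed blast
  interpret h: group_hom "As X" "GL s" h
    using h(1) by unfold_locales
  let ?n = "B.ord (left_trans X x0)"
  let ?z = "As_gen X x0 [^]\<^bsub>As X\<^esub> ?n"
  have "left_trans X x0 [^]\<^bsub>BijGroup (carrier X)\<^esub> ?n = \<one>\<^bsub>BijGroup (carrier X)\<^esub>"
    using B.pow_ord_eq_1 left_trans_Bij[OF X x0] by blast
  then have "stabilizing_family X (replicate ?n x0)"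
    using x0 by (auto simp: stabilizing_family_def left_trans_Bij[OF X x0]
      family_prod_replicate[where f="left_trans X", OF group_BijGroup])
  then have "\<rho> x0 [^]\<^bsub>GL s\<^esub> ?n = \<one>\<^bsub>GL s\<^esub>"
    using \<rho> family_prod_replicate[where f=\<rho> and x=x0 and n="?n", OF group_GL[OF s] funcset_mem[OF \<rho>_in x0]]
    by (simp add: strong_rep_def)
  then have "h ?z = \<one>\<^bsub>GL s\<^esub>"
    using x0 by (simp add: h.hom_nat_pow As_gen_closed h(2))
  then have "{?z} \<subseteq> kernel (As X) (GL s) h"
    using x0 by (simp add: kernel_def As_gen_closed)
  then have "env_subgroup X x0 \<subseteq> kernel (As X) (GL s) h"
    unfolding env_subgroup_def by (rule A.generate_subgroup_incl[OF _ h.subgroup_kernel])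
  then obtain g where g: "g \<in> hom (As X Mod env_subgroup X x0) (GL s)"
      "\<And>a. a \<in> carrier (As X) \<Longrightarrow> g (env_subgroup X x0 #>\<^bsub>As X\<^esub> a) = h a"
    using h.FactGroup_universal_kernel[OF env_subgroup_normal[OF X x0]] by blast
  define r where "r = restrict g (carrier (fin_env_group X x0))"
  have "r \<in> hom (fin_env_group X x0) (GL s)"
    using g(1) F.m_closed unfolding r_def hom_def fin_env_group_def by auto
  moreover have "r (env_gen X x0 x) = \<rho> x" if "x \<in> carrier X" for x
    using that env_gen_closed[OF that, of x0] by (simp add: r_def env_gen_def g(2) As_gen_closed h(2))
  moreover have "r \<in> extensional (carrier (fin_env_group X x0))" by (simp add: r_def)
  ultimately show "\<exists>r. group_rep (fin_env_group X x0) s r \<and>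
     r \<in> extensional (carrier (fin_env_group X x0)) \<and> (\<forall>x\<in>carrier X. r (env_gen X x0 x) = \<rho> x)"
    using s F.is_group by (auto simp: group_rep_def)
next
  fix r r'
  assume r: "group_rep (fin_env_group X x0) s r \<and>
     r \<in> extensional (carrier (fin_env_group X x0)) \<and> (\<forall>x\<in>carrier X. r (env_gen X x0 x) = \<rho> x)"
   and r': "group_rep (fin_env_group X x0) s r' \<and>
     r' \<in> extensional (carrier (fin_env_group X x0)) \<and> (\<forall>x\<in>carrier X. r' (env_gen X x0 x) = \<rho> x)"
  then have s: "vector_space s" by (simp add: group_rep_def)
  interpret r: group_hom "fin_env_group X x0" "GL s" r
    using r group_GL[OF s] by (simp add: group_rep_def group_hom_def group_hom_axioms_def)
  interpret r': group_hom "fin_env_group X x0" "GL s" r'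
    using r' group_GL[OF s] by (simp add: group_rep_def group_hom_def group_hom_axioms_def)
  have "r g = r' g" if "g \<in> generate (fin_env_group X x0) (env_gen X x0 ` carrier X)" for g
    using that
  proof (induction rule: generate.induct)
    case (incl h)
    then show ?case using r r' by auto
  next
    case (inv h)
    then show ?case using r r' env_gen_closed[of _ X x0] by auto
  next
    case (eng h1 h2)
    then show ?case using fin_env_group_generate[OF X x0] by (metis r.hom_mult r'.hom_mult)
  qed auto
  then show "r = r'"
    using r r' fin_env_group_generate[OF X x0]
    by (intro extensionalityI[of r "carrier (fin_env_group X x0)"]) simp_all
qed

lemma induced_rep:
  assumes "rack X" "x0 \<in> carrier X" "strong_rep X s \<rho>"
  shows "group_rep (fin_env_group X x0) s (induced_rep X x0 s \<rho>)"
    and "x \<in> carrier X \<Longrightarrow> induced_rep X x0 s \<rho> (env_gen X x0 x) = \<rho> x"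
  using theI'[OF induced_rep_ex1[OF assms]] unfolding induced_rep_def by auto

end

theory Submission
  imports Defs
begin

text \<open>
  The isomorphism \<open>T\<close> that witnesses the equivalence of the rack representations also
  intertwines the induced group representations. For a fixed \<open>T\<close>, the group elements on which
  two group representations are intertwined by \<open>T\<close> form a subgroup
  (\<open>intertwines_generate\<close>). By hypothesis this subgroup contains the classes of all generators
  \<open>g\<^sub>x\<close>, because the induced representations take there the values \<open>\<rho>\<^sub>x\<close> and \<open>\<phi>\<^sub>x\<close>, and
  these classes generate the finite enveloping group.
\<close>

lemma group_rep_one:
  assumes "group_rep G s \<rho>"
  shows "\<rho> \<one>\<^bsub>G\<^esub> = id"
  using assms hom_one[of \<rho> G "GL s"] group_GL[of s]
  by (simp add: group_rep_def GL_def)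

lemma group_rep_mult:
  assumes "group_rep G s \<rho>" "g \<in> carrier G" "h \<in> carrier G"
  shows "\<rho> (g \<otimes>\<^bsub>G\<^esub> h) = \<rho> g \<circ> \<rho> h"
  using assms hom_mult[of \<rho> G "GL s" g h] by (simp add: group_rep_def GL_def)

text \<open>
  The only closure property that takes an argument is the one under inverses:
  \<open>\<phi>\<^sub>h\<^sup>-\<^sup>1 T = \<phi>\<^sub>h\<^sup>-\<^sup>1 (T \<rho>\<^sub>h) \<rho>\<^sub>h\<^sup>-\<^sup>1 = \<phi>\<^sub>h\<^sup>-\<^sup>1 (\<phi>\<^sub>h T) \<rho>\<^sub>h\<^sup>-\<^sup>1 = T \<rho>\<^sub>h\<^sup>-\<^sup>1\<close>.
\<close>

lemma intertwines_generate:
  assumes \<rho>: "group_rep G s \<rho>" and \<phi>: "group_rep G t \<phi>" and A: "A \<subseteq> carrier G"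
    and T: "\<And>a. a \<in> A \<Longrightarrow> \<phi> a \<circ> T = T \<circ> \<rho> a"
    and g: "g \<in> generate G A"
  shows "\<phi> g \<circ> T = T \<circ> \<rho> g"
proof -
  interpret G: group G using \<rho> by (simp add: group_rep_def)
  from g show ?thesis
  proof (induction rule: generate.induct)
    case one
    show ?case by (simp add: group_rep_one[OF \<rho>] group_rep_one[OF \<phi>])
  next
    case (incl h)
    then show ?case by (rule T)
  next
    case (inv h)
    then have h: "h \<in> carrier G" using A by blast
    have \<rho>_inv: "\<rho> h \<circ> \<rho> (inv\<^bsub>G\<^esub> h) = id"
      using h group_rep_mult[OF \<rho> h, of "inv\<^bsub>G\<^esub> h"] by (simp add: group_rep_one[OF \<rho>])
    have \<phi>_inv: "\<phi> (inv\<^bsub>G\<^esub> h) \<circ> \<phi> h = id"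
      using h group_rep_mult[OF \<phi> _ h, of "inv\<^bsub>G\<^esub> h"] by (simp add: group_rep_one[OF \<phi>])
    have "\<phi> (inv\<^bsub>G\<^esub> h) \<circ> T = \<phi> (inv\<^bsub>G\<^esub> h) \<circ> (T \<circ> \<rho> h) \<circ> \<rho> (inv\<^bsub>G\<^esub> h)"
      using \<rho>_inv by (simp add: comp_assoc)
    also have "\<dots> = (\<phi> (inv\<^bsub>G\<^esub> h) \<circ> \<phi> h) \<circ> T \<circ> \<rho> (inv\<^bsub>G\<^esub> h)"
      by (simp only: T[OF inv, symmetric] comp_assoc)
    finally show ?case by (simp add: \<phi>_inv)
  next
    case (eng h1 h2)
    then have h: "h1 \<in> carrier G" "h2 \<in> carrier G"
      using G.generate_in_carrier[OF A] by blast+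
    have "\<phi> (h1 \<otimes>\<^bsub>G\<^esub> h2) \<circ> T = \<phi> h1 \<circ> (\<phi> h2 \<circ> T)"
      by (simp add: group_rep_mult[OF \<phi> h] comp_assoc)
    also have "\<dots> = (\<phi> h1 \<circ> T) \<circ> \<rho> h2" by (simp only: eng.IH(2) comp_assoc)
    also have "\<dots> = T \<circ> \<rho> (h1 \<otimes>\<^bsub>G\<^esub> h2)"
      by (simp only: eng.IH(1) group_rep_mult[OF \<rho> h] comp_assoc)
    finally show ?case .
  qed
qed

theorem theorem6p2:
  fixes X :: "('a, 'm) rack_scheme" and x0 :: 'a
    and s :: "'k::field \<Rightarrow> 'v::ab_group_add \<Rightarrow> 'v" and t :: "'k \<Rightarrow> 'w::ab_group_add \<Rightarrow> 'w"
    and \<rho> :: "'a \<Rightarrow> 'v \<Rightarrow> 'v" and \<phi> :: "'a \<Rightarrow> 'w \<Rightarrow> 'w"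
  assumes "connected_rack X" and "finite (carrier X)" and "x0 \<in> carrier X"
    and "vector_space s" and "vector_space t"
    and "strong_rep X s \<rho>" and "strong_rep X t \<phi>"
    and "rack_rep_equiv X s \<rho> t \<phi>"
  shows "group_rep_equiv (fin_env_group X x0) s (induced_rep X x0 s \<rho>) t (induced_rep X x0 t \<phi>)"
proof -
  have X: "rack X" using assms(1) by (simp add: connected_rack_def)
  note \<rho> = induced_rep[OF X assms(3) assms(6)] and \<phi> = induced_rep[OF X assms(3) assms(7)]
  obtain T where T: "Vector_Spaces.linear s t T" "bij T"
    and gen: "\<And>x. x \<in> carrier X \<Longrightarrow> \<phi> x \<circ> T = T \<circ> \<rho> x"
    using assms(8) by (auto simp: rack_rep_equiv_def)
  have "induced_rep X x0 t \<phi> g \<circ> T = T \<circ> induced_rep X x0 s \<rho> g"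
    if "g \<in> carrier (fin_env_group X x0)" for g
  proof (rule intertwines_generate[OF \<rho>(1) \<phi>(1)])
    show "env_gen X x0 ` carrier X \<subseteq> carrier (fin_env_group X x0)"
      by (rule image_subsetI) (rule env_gen_closed)
    show "g \<in> generate (fin_env_group X x0) (env_gen X x0 ` carrier X)"
      using that fin_env_group_generate[OF X assms(3)] by simp
    show "induced_rep X x0 t \<phi> a \<circ> T = T \<circ> induced_rep X x0 s \<rho> a"
      if "a \<in> env_gen X x0 ` carrier X" for a
      using that gen \<rho>(2) \<phi>(2) by auto
  qed
  with T \<rho>(1) \<phi>(1) show ?thesis unfolding group_rep_equiv_def by blast
qed

end
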